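(* Let $n=2p_{1}^{J_{1}}p_{2}^{J_{2}}\cdots p_{s}^{J_{s}}$, where $s\geq2$, $p_1,\dots,p_s$ are distinct odd primes, $J_i\ge1$, and for every $r\in\{1,\dots,s-1\}$ we have $\prod_{i=1}^{r}p_{i}^{J_{i}}<p_{r+1}$. Let $\mathcal{D}_{S_{1}},\mathcal{D}_{S_{2}}$ be subsets of $\mathcal{D}_{[n]}\setminus\{n\}$. If $\mathrm{Spec}(\mathrm{ICG}(n,\mathcal{D}_{S_{1}}))=\mathrm{Spec}(\mathrm{ICG}(n,\mathcal{D}_{S_{2}}))$, then $\mathcal{D}_{S_{1}}=\mathcal{D}_{S_{2}}$.
   Context: For an integer $n\ge1$, identify $\mathbb{Z}_n$ with $[n]=\{1,\dots,n\}$ ($n$ playing the role of $0$). For a positive divisor $d$ of $n$, $G_n(d)=\{j\in[n]:\gcd(j,n)=d\}$. $\mathcal{D}_{[n]}$ denotes the set of all positive divisors of $n$. For $\mathcal{D}\subseteq\mathcal{D}_{[n]}\setminus\{n\}$, $\mathrm{ICG}(n,\mathcal{D})$ denotes the circulant graph $\mathrm{Cay}(\mathbb{Z}_n,S)$ with connection set $S=\bigcup_{d\in\mathcal{D}}G_n(d)$ (vertex set $\mathbb{Z}_n$, $g\sim h$ iff $h-g\in S$); we write $\mathcal{D}=\mathcal{D}_S$. $\mathrm{Spec}$ denotes the multiset of eigenvalues of the adjacency matrix. *)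

theory Defs
  imports "Jordan_Normal_Form.Char_Poly" "HOL-Computational_Algebra.Fundamental_Theorem_Algebra"
begin

text \<open>Z_n identified with [n] = {1..n}; the representative in [n] of an integer a.\<close>
definition zn_rep :: "nat \<Rightarrow> int \<Rightarrow> nat" where
  "zn_rep n a = (if a mod int n = 0 then n else nat (a mod int n))"

definition G_n :: "nat \<Rightarrow> nat \<Rightarrow> nat set" where
  "G_n n d = {j \<in> {1..n}. gcd j n = d}"

definition divisors_n :: "nat \<Rightarrow> nat set" where
  "divisors_n n = {d. 0 < d \<and> d dvd n}"

definition conn_set :: "nat \<Rightarrow> nat set \<Rightarrow> nat set" where
  "conn_set n D = (\<Union>d\<in>D. G_n n d)"

text \<open>Adjacency matrix of Cay(Z_n, S), vertices 1..n stored at matrix indices 0..n-1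
  (vertex g at index g-1); g ~ h iff h - g in S (taken in [n]).\<close>
definition circulant_adj :: "nat \<Rightarrow> nat set \<Rightarrow> complex mat" where
  "circulant_adj n S = mat n n (\<lambda>(i, j).
     if zn_rep n (int (j + 1) - int (i + 1)) \<in> S then 1 else 0)"

definition ICG_adj :: "nat \<Rightarrow> nat set \<Rightarrow> complex mat" where
  "ICG_adj n D = circulant_adj n (conn_set n D)"

definition Spec :: "complex mat \<Rightarrow> complex multiset" where
  "Spec A = proots (char_poly A)"

end

theory Submission
  imports Defs "HOL-Number_Theory.Totient"
begin

text \<open>Write \<open>n = 2m\<close> with \<open>m\<close> odd. The eigenvalues \<open>e k\<close> of the graph satisfy
  \<open>e (n - k) = e k\<close>, because the connection set is closed under negation. Hence only
  \<open>e 0\<close> and \<open>e m\<close> can have odd multiplicity. The former is the degree, which is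
  the eigenvalue of largest modulus, so the spectrum determines both. They are the sum and the
  difference of the numbers of even and odd elements of the connection set, and these two numbers
  are sums of Euler's totient function over distinct divisors of \<open>m\<close>. The growth condition
  on the primes makes such subset sums unique, so the two numbers determine the divisor set.\<close>

section \<open>Subset sums of totients of divisors\<close>

text \<open>The property fails for every even \<open>m\<close>, since \<open>{1}\<close> and
  \<open>{2}\<close> both have sum 1. It is therefore used only for the odd part of
  \<open>n\<close>.\<close>

definition distinct_totient_sums :: "nat \<Rightarrow> bool" where
  "distinct_totient_sums m \<longleftrightarrow> inj_on (sum totient) (Pow {d. d dvd m})"

text \<open>Uniqueness of base \<open>b\<close> expansions, with signed digits because they will be
  differences of sums. Modulo \<open>b\<close> only \<open>u 0\<close> survives, and 0 is the only
  multiple of \<open>b\<close> of modulus below \<open>b\<close>; dividing by \<open>b\<close>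
  shifts the digits.\<close>

lemma base_expansion_eq_0:
  fixes u :: "nat \<Rightarrow> int" and b :: int
  assumes "(\<Sum>a<J. b ^ a * u a) = 0" and "\<And>a. a < J \<Longrightarrow> \<bar>u a\<bar> < b" and "a < J"
  shows "u a = 0"
  using assms
proof (induction J arbitrary: u a)
  case 0
  then show ?case by simp
next
  case (Suc J)
  have b: "b > 0" using Suc.prems(2)[of 0] by linarith
  have split: "(\<Sum>a<Suc J. b ^ a * u a) = u 0 + b * (\<Sum>a<J. b ^ a * u (Suc a))"
    by (subst sum.lessThan_Suc_shift) (simp add: sum_distrib_left mult.assoc)
  have "b dvd u 0"
    using Suc.prems(1) unfolding split
    by (metis add.commute dvd_triv_left dvd_minus_iff eq_neg_iff_add_eq_0)
  then have u0: "u 0 = 0"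
    using Suc.prems(2)[of 0] dvd_imp_le_int[of "u 0" b] b by auto
  then have rest: "(\<Sum>a<J. b ^ a * u (Suc a)) = 0"
    using Suc.prems(1) b unfolding split by simp
  show ?case
  proof (cases a)
    case 0
    then show ?thesis using u0 by simp
  next
    case (Suc a')
    then show ?thesis
      using Suc.IH[OF rest, of a'] Suc.prems(2,3) by simp
  qed
qed

text \<open>Each divisor of \<open>m * q ^ J\<close> is uniquely \<open>d * q ^ a\<close> with
  \<open>d dvd m\<close> and \<open>a \<le> J\<close>, and the totient is multiplicative on these
  coprime factors. So \<open>X\<close> is cut into slices by the exponent of
  \<open>q\<close>.\<close>

lemma sum_totient_prime_power_mult:
  fixes m q J :: nat
  assumes q: "prime q" and ndvd: "\<not> q dvd m" and X: "X \<subseteq> {d. d dvd m * q ^ J}"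
  shows "sum totient X = (\<Sum>a\<le>J. totient (q ^ a) * sum totient {d. d dvd m \<and> d * q ^ a \<in> X})"
proof -
  have m: "m > 0" using ndvd by (cases m) auto
  have q0: "q > 0" "q > 1" using prime_gt_1_nat[OF q] by auto
  define Y where "Y a = {d. d dvd m \<and> d * q ^ a \<in> X}" for a
  have fin: "finite (Y a)" for a
    by (rule finite_subset[of _ "{d. d dvd m}"]) (use m in \<open>auto simp: Y_def\<close>)
  have cop: "coprime d (q ^ a)" if "d dvd m" for d a
  proof -
    have "\<not> q dvd d" using that ndvd dvd_trans by blast
    then have "coprime q d" using q by (simp add: prime_imp_coprime)
    then show ?thesis by (simp add: coprime_commute)
  qed
  have bij: "bij_betw (\<lambda>(a, d). d * q ^ a) (SIGMA a:{..J}. Y a) X"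
  proof (rule bij_betw_imageI)
    show "inj_on (\<lambda>(a, d). d * q ^ a) (SIGMA a:{..J}. Y a)"
    proof (rule inj_onI, clarify)
      fix a d a' d' assume d: "d \<in> Y a" "d' \<in> Y a'" and eq: "d * q ^ a = d' * q ^ a'"
      \<comment> \<open>As \<open>q\<close> does not divide \<open>e\<close>, the exponent can be
        read off the product.\<close>
      have *: "multiplicity q (e * q ^ k) = k" "e \<noteq> 0" if "e dvd m" for e k
      proof -
        have "\<not> q dvd e" using that ndvd dvd_trans by blast
        then show "multiplicity q (e * q ^ k) = k"
          using q by (intro multiplicity_eqI) (auto simp: q0)
        show "e \<noteq> 0" using that m by auto
      qed
      have "a = a'" using *(1)[of d a] *(1)[of d' a'] d eq by (auto simp: Y_def)
      then show "a = a' \<and> d = d'" using eq q0 by simp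
    qed
    show "(\<lambda>(a, d). d * q ^ a) ` (SIGMA a:{..J}. Y a) = X"
    proof
      show "(\<lambda>(a, d). d * q ^ a) ` (SIGMA a:{..J}. Y a) \<subseteq> X" by (auto simp: Y_def)
      show "X \<subseteq> (\<lambda>(a, d). d * q ^ a) ` (SIGMA a:{..J}. Y a)"
      proof
        fix x assume x: "x \<in> X"
        then have "x dvd m * q ^ J" using X by auto
        then obtain d c where dc: "x = d * c" "d dvd m" "c dvd q ^ J"
          using division_decomp by blast
        then obtain a where a: "a \<le> J" "c = q ^ a"
          using q by (auto simp: divides_primepow_nat)
        show "x \<in> (\<lambda>(a, d). d * q ^ a) ` (SIGMA a:{..J}. Y a)"
          by (rule image_eqI[of _ _ "(a, d)"]) (use dc a x in \<open>auto simp: Y_def\<close>)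
      qed
    qed
  qed
  have "sum totient X = (\<Sum>(a, d)\<in>(SIGMA a:{..J}. Y a). totient (d * q ^ a))"
    using sum.reindex_bij_betw[OF bij, of totient] by (simp add: case_prod_unfold)
  also have "\<dots> = (\<Sum>a\<le>J. \<Sum>d\<in>Y a. totient (d * q ^ a))"
    by (rule sum.Sigma[symmetric]) (auto simp: fin)
  also have "\<dots> = (\<Sum>a\<le>J. totient (q ^ a) * sum totient (Y a))"
    unfolding sum_distrib_left
    by (intro sum.cong refl) (auto simp: Y_def totient_mult_coprime[OF cop])
  finally show ?thesis by (simp add: Y_def)
qed

text \<open>Let \<open>t a\<close> be the difference of the totient sums of the two slices at
  exponent \<open>a\<close>. The weights are 1 for \<open>a = 0\<close> and
  \<open>(q - 1) * q ^ (a - 1)\<close> otherwise, so a vanishing weighted sum of small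
  \<open>t a\<close> forces each to vanish: \<open>t 0\<close> modulo \<open>q - 1\<close>, the
  others as base \<open>q\<close> digits. The property of \<open>m\<close> then identifies the
  slices.\<close>

lemma distinct_totient_sums_mult_prime_power:
  fixes m q J :: nat
  assumes m: "distinct_totient_sums m" "odd m" "m < q" and q: "prime q" "odd q"
  shows "distinct_totient_sums (m * q ^ J)"
  unfolding distinct_totient_sums_def
proof (rule inj_onI)
  fix X X' assume X: "X \<in> Pow {d. d dvd m * q ^ J}" "X' \<in> Pow {d. d dvd m * q ^ J}"
    and eq: "sum totient X = sum totient X'"
  have m0: "m > 0" using m by (cases m) auto
  have ndvd: "\<not> q dvd m" using m m0 by (auto dest: dvd_imp_le)
  define Y where "Y X a = {d. d dvd m \<and> d * q ^ a \<in> X}" for X a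
  define t where "t a = int (sum totient (Y X a)) - int (sum totient (Y X' a))" for a
  have le: "sum totient (Y Z a) \<le> m" for Z a
  proof -
    have "sum totient (Y Z a) \<le> (\<Sum>d | d dvd m. totient d)"
      by (rule sum_mono2) (use m0 in \<open>auto simp: Y_def\<close>)
    then show ?thesis by (simp add: totient_divisor_sum)
  qed
  \<comment> \<open>Parity improves \<open>m < q\<close> to \<open>m < q - 1\<close>, which the
    argument modulo \<open>q - 1\<close> needs. Each slice sum lies between 0 and \<open>m\<close>,
    because the totients of all divisors of \<open>m\<close> add up to \<open>m\<close>.\<close>
  have "m + 1 \<noteq> q" using m q by auto
  then have "m + 1 < q" using m by linarith
  then have t_lt: "\<bar>t a\<bar> < int q - 1" for a
    using le[of X a] le[of X' a] unfolding t_def by linarith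
  have "(\<Sum>a\<le>J. int (totient (q ^ a)) * t a) = 0"
    using eq sum_totient_prime_power_mult[OF q(1) ndvd, of X J]
      sum_totient_prime_power_mult[OF q(1) ndvd, of X' J] X
    by (simp add: t_def Y_def right_diff_distrib sum_subtractf flip: of_nat_mult of_nat_sum)
  \<comment> \<open>The exponent 0 is split off: it alone has a totient without the factor
    \<open>q - 1\<close>.\<close>
  also have "(\<Sum>a\<le>J. int (totient (q ^ a)) * t a) = t 0 + (\<Sum>a<J. int (totient (q ^ Suc a)) * t (Suc a))"
    by (simp only: lessThan_Suc_atMost[symmetric] sum.lessThan_Suc_shift) simp
  also have "(\<Sum>a<J. int (totient (q ^ Suc a)) * t (Suc a)) = (int q - 1) * (\<Sum>a<J. int q ^ a * t (Suc a))"
    unfolding sum_distrib_left using q prime_gt_0_nat[OF q(1)]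
    by (intro sum.cong refl)
       (simp add: totient_prime_power_Suc of_nat_diff mult_ac del: power_Suc)
  finally have sum0: "t 0 + (int q - 1) * (\<Sum>a<J. int q ^ a * t (Suc a)) = 0" .
  then have "(int q - 1) dvd t 0"
    by (metis add.commute dvd_triv_left dvd_minus_iff eq_neg_iff_add_eq_0)
  then have t0: "t 0 = 0"
    using t_lt[of 0] dvd_imp_le_int[of "t 0" "int q - 1"] by auto
  then have "(\<Sum>a<J. int q ^ a * t (Suc a)) = 0" using sum0 t_lt[of 0] by auto
  moreover have "\<bar>t a\<bar> < int q" for a using t_lt[of a] by linarith
  ultimately have tS: "t (Suc a) = 0" if "a < J" for a
    using base_expansion_eq_0[of "int q" "\<lambda>a. t (Suc a)" J a] that by blast
  have Yeq: "Y X a = Y X' a" if "a \<le> J" for a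
  proof -
    have "t a = 0" using t0 tS that by (cases a) auto
    then have "sum totient (Y X a) = sum totient (Y X' a)" unfolding t_def by linarith
    then show ?thesis
      by (intro inj_onD[OF m(1)[unfolded distinct_totient_sums_def]]) (auto simp: Y_def)
  qed
  have "x \<in> X \<longleftrightarrow> x \<in> X'" if x: "x dvd m * q ^ J" for x
  proof -
    from x obtain d c where dc: "x = d * c" "d dvd m" "c dvd q ^ J"
      using division_decomp by blast
    then obtain a where a: "a \<le> J" "c = q ^ a"
      using q by (auto simp: divides_primepow_nat)
    show ?thesis using Yeq[OF a(1)] dc a by (auto simp: Y_def)
  qed
  then show "X = X'" using X by blast
qed

text \<open>Induction adding one prime power at a time. Oddness is carried along because the step
  requires it of the previous product.\<close>

lemma distinct_totient_sums_prod:
  fixes p J :: "nat \<Rightarrow> nat"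
  assumes "\<And>i. i \<in> {1..r} \<Longrightarrow> prime (p i) \<and> odd (p i)"
    and "\<And>k. k \<in> {1..<r} \<Longrightarrow> (\<Prod>i=1..k. p i ^ J i) < p (k + 1)"
  shows "distinct_totient_sums (\<Prod>i=1..r. p i ^ J i) \<and> odd (\<Prod>i=1..r. p i ^ J i)"
  using assms
proof (induction r)
  case 0
  have "Pow {d::nat. d dvd 1} = {{}, {1}}" by auto
  then show ?case by (simp add: distinct_totient_sums_def inj_on_def)
next
  case (Suc r)
  let ?m = "\<Prod>i=1..r. p i ^ J i"
  have IH: "distinct_totient_sums ?m" "odd ?m"
    using Suc.IH Suc.prems by auto
  have pr: "prime (p (Suc r))" "odd (p (Suc r))" using Suc.prems(1)[of "Suc r"] by auto
  have "?m < p (Suc r)"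
  \<comment> \<open>The growth hypothesis starts at \<open>k = 1\<close>; for the first prime the
    empty product 1 is compared directly.\<close>
  proof (cases "r = 0")
    case True
    then show ?thesis using pr prime_gt_1_nat by simp
  next
    case False
    then show ?thesis using Suc.prems(2)[of r] by simp
  qed
  then show ?case
    using distinct_totient_sums_mult_prime_power[OF IH _ pr, of "J (Suc r)"] IH pr by simp
qed

section \<open>The spectrum of a circulant graph\<close>

definition circulant_eigenvalue :: "nat \<Rightarrow> nat set \<Rightarrow> nat \<Rightarrow> complex" where
  "circulant_eigenvalue n S k = (\<Sum>l\<in>S. cis (2 * pi / n) ^ (l * k))"

lemma cis_root_power: "n > 0 \<Longrightarrow> cis (2 * pi / real n) ^ n = 1"
  by (simp add: DeMoivre)

lemma cis_root_power_cong:
  assumes "n > 0" and "[a = b] (mod n)"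
  shows "cis (2 * pi / real n) ^ a = cis (2 * pi / real n) ^ b"
proof -
  have "cis (2 * pi / real n) ^ a = cis (2 * pi / real n) ^ (a mod n)" for a
    by (subst (1) mult_div_mod_eq[of n a, symmetric])
       (simp only: power_add power_mult cis_root_power[OF assms(1)], simp)
  then show ?thesis using assms(2) by (metis cong_def)
qed

text \<open>Orthogonality of characters: the terms are powers of an \<open>n\<close>-th root of
  unity, which differs from 1 when \<open>i \<noteq> j\<close>, so the geometric sum
  vanishes.\<close>

lemma sum_cis_root_power_ratio:
  assumes "n > 0" "i < n" "j < n"
  defines "w \<equiv> cis (2 * pi / real n)"
  shows "(\<Sum>k<n. w ^ (i * k) / w ^ (j * k)) = (if i = j then of_nat n else 0)"
proof (cases "i = j")
  case True
  then show ?thesis by (simp add: w_def)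
next
  case False
  define z where "z = w ^ i / w ^ j"
  have w: "w ^ k = cis (2 * pi * real k / real n)" for k
    by (simp add: w_def DeMoivre mult_ac)
  have "w ^ i \<noteq> w ^ j"
    using bij_betw_imp_inj_on[OF bij_betw_roots_unity[OF assms(1)]] False assms(2,3)
    unfolding w inj_on_def by blast
  then have "z \<noteq> 1" by (simp add: z_def)
  have "w ^ n = 1" using cis_root_power[OF assms(1)] by (simp add: w_def)
  then have "z ^ n = 1"
    by (metis z_def div_by_1 mult.commute power_divide power_mult power_one)
  have "(\<Sum>k<n. w ^ (i * k) / w ^ (j * k)) = (\<Sum>k<n. z ^ k)"
    by (simp add: z_def power_divide power_mult)
  also have "\<dots> = 0" using \<open>z \<noteq> 1\<close> \<open>z ^ n = 1\<close> by (simp add: geometric_sum)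
  finally show ?thesis using False by simp
qed

text \<open>Translation by \<open>-i\<close> permutes the residues, so a sum along row
  \<open>i\<close> of the matrix can be rewritten as a sum over the elements of
  \<open>{1..n}\<close>.\<close>

lemma zn_rep_bij:
  assumes "n > 0"
  shows "bij_betw (\<lambda>j. zn_rep n (int j - int i)) {..<n} {1..n}"
proof -
  let ?f = "\<lambda>j. zn_rep n (int j - int i)"
  have range: "?f j \<in> {1..n}" for j
    using assms pos_mod_bound[of "int n" "int j - int i"] pos_mod_sign[of "int n" "int j - int i"]
    by (auto simp: zn_rep_def nat_le_iff simp del: pos_mod_bound pos_mod_sign)
  have cong: "int (?f j) mod int n = (int j - int i) mod int n" for j
    using assms by (auto simp: zn_rep_def)
  have "inj_on ?f {..<n}"
  proof (rule inj_onI)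
    fix a b assume ab: "a \<in> {..<n}" "b \<in> {..<n}" "?f a = ?f b"
    then have "(int a - int i) mod int n = (int b - int i) mod int n" using cong by metis
    then have "(int a - int i + int i) mod int n = (int b - int i + int i) mod int n"
      by (metis mod_add_left_eq)
    then show "a = b" using ab by simp
  qed
  moreover have "?f ` {..<n} = {1..n}"
    by (rule card_subset_eq) (use range card_image[OF calculation] in auto)
  ultimately show ?thesis by (rule bij_betw_imageI)
qed

lemma cong_add_zn_rep:
  assumes "n > 0"
  shows "[j = i + zn_rep n (int j - int i)] (mod n)"
proof -
  have "int (zn_rep n (int j - int i)) mod int n = (int j - int i) mod int n"
    using assms by (auto simp: zn_rep_def)
  then have "(int i + int (zn_rep n (int j - int i))) mod int n = int j mod int n"
    by (metis add.commute diff_add_cancel mod_add_right_eq)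
  then show ?thesis by (simp add: cong_def flip: of_nat_mod of_nat_add)
qed

text \<open>Substituting \<open>j = i + l\<close> modulo \<open>n\<close> splits the character value
  into a factor for \<open>i\<close> and a factor for \<open>l\<close>; the latter is summed over
  \<open>S\<close>.\<close>

lemma circulant_adj_eigenvector:
  assumes "n > 0" "S \<subseteq> {1..n}"
  defines "w \<equiv> cis (2 * pi / real n)"
  shows "(\<Sum>j<n. (if zn_rep n (int j - int i) \<in> S then 1 else 0) * w ^ (j * k)) =
    w ^ (i * k) * circulant_eigenvalue n S k"
proof -
  let ?f = "\<lambda>j. zn_rep n (int j - int i)"
  have "w ^ (j * k) = w ^ ((i + ?f j) * k)" for j
    unfolding w_def
    by (rule cis_root_power_cong[OF assms(1)]) (intro cong_mult cong_add_zn_rep assms cong_refl)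
  then have "(\<Sum>j<n. (if ?f j \<in> S then 1 else 0) * w ^ (j * k)) =
      (\<Sum>j<n. (if ?f j \<in> S then 1 else 0) * w ^ ((i + ?f j) * k))" by simp
  also have "\<dots> = (\<Sum>l\<in>{1..n}. (if l \<in> S then 1 else 0) * w ^ ((i + l) * k))"
    by (rule sum.reindex_bij_betw[OF zn_rep_bij[OF assms(1)],
          where g = "\<lambda>l. (if l \<in> S then 1 else 0) * w ^ ((i + l) * k)"])
  also have "\<dots> = (\<Sum>l\<in>S. w ^ ((i + l) * k))"
    by (rule sum.mono_neutral_cong_right) (use assms in auto)
  also have "\<dots> = w ^ (i * k) * circulant_eigenvalue n S k"
    by (simp add: circulant_eigenvalue_def w_def sum_distrib_left power_add add_mult_distrib)
  finally show ?thesis .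
qed

lemma Spec_circulant_adj:
  assumes n: "n > 0" and S: "S \<subseteq> {1..n}"
  shows "Spec (circulant_adj n S) = image_mset (circulant_eigenvalue n S) (mset_set {..<n})"
proof -
  define w where "w = cis (2 * pi / real n)"
  define A where "A = circulant_adj n S"
  \<comment> \<open>The columns of \<open>P\<close> are the characters, and \<open>Q\<close> is its
    inverse by orthogonality. The diagonal matrix \<open>B\<close> keeps one entry per frequency, so
    coinciding eigenvalues are counted with multiplicity.\<close>
  define P where "P = mat n n (\<lambda>(i, k). w ^ (i * k))"
  define Q where "Q = mat n n (\<lambda>(k, j). 1 / (of_nat n * w ^ (j * k)))"
  define B where "B = mat n n (\<lambda>(i, j). if i = j then circulant_eigenvalue n S i else 0)"
  have carr: "A \<in> carrier_mat n n" "B \<in> carrier_mat n n" "P \<in> carrier_mat n n" "Q \<in> carrier_mat n n"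
    by (auto simp: A_def B_def P_def Q_def circulant_adj_def)
  have PQ: "P * Q = 1\<^sub>m n"
  proof (rule eq_matI)
    fix i j assume ij: "i < dim_row (1\<^sub>m n :: complex mat)" "j < dim_col (1\<^sub>m n :: complex mat)"
    then have "(P * Q) $$ (i, j) = (\<Sum>k<n. w ^ (i * k) / w ^ (j * k)) / of_nat n"
      by (simp add: P_def Q_def scalar_prod_def lessThan_atLeast0 sum_divide_distrib field_simps)
    then show "(P * Q) $$ (i, j) = 1\<^sub>m n $$ (i, j)"
      using sum_cis_root_power_ratio[OF n, of i j] ij n by (simp add: w_def)
  qed (auto simp: P_def Q_def)
  have QP: "Q * P = 1\<^sub>m n" by (rule mat_mult_left_right_inverse) (use carr PQ in auto)
  have "A * P = P * B"
  proof (rule eq_matI)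
    fix i k assume ik: "i < dim_row (P * B)" "k < dim_col (P * B)"
    then have ik: "i < n" "k < n" using carr by auto
    have "(A * P) $$ (i, k) =
        (\<Sum>j<n. (if zn_rep n (int j - int i) \<in> S then 1 else 0) * w ^ (j * k))"
      using ik by (simp add: A_def P_def circulant_adj_def scalar_prod_def lessThan_atLeast0)
    also have "\<dots> = w ^ (i * k) * circulant_eigenvalue n S k"
      unfolding w_def by (rule circulant_adj_eigenvector[OF n S])
    also have "\<dots> = (P * B) $$ (i, k)"
      using ik by (simp add: P_def B_def scalar_prod_def if_distrib cong: if_cong)
    finally show "(A * P) $$ (i, k) = (P * B) $$ (i, k)" .
  qed (use carr in auto)
  then have "P * B * Q = A * P * Q" by simp
  also have "\<dots> = A" using carr PQ by (simp add: assoc_mult_mat[of A n n P n Q n])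
  finally have "similar_mat A B"
    by (intro similar_matI[of _ _ P Q n]) (use carr PQ QP in auto)
  then have "char_poly A = char_poly B" by (rule char_poly_similar)
  also have "\<dots> = (\<Prod>a\<leftarrow>diag_mat B. [:- a, 1:])"
    by (rule char_poly_upper_triangular[OF carr(2)]) (auto simp: B_def)
  also have "diag_mat B = map (circulant_eigenvalue n S) [0..<n]"
    by (auto simp: diag_mat_def B_def)
  finally have "char_poly A = (\<Prod>k\<in>{..<n}. [:- circulant_eigenvalue n S k, 1:])"
    by (simp add: prod.list_conv_set_nth lessThan_atLeast0)
  then have "Spec A = (\<Sum>k\<in>{..<n}. {#circulant_eigenvalue n S k#})"
    by (simp add: Spec_def proots_prod)
  then show ?thesis by (simp add: A_def sum_unfold_sum_mset)
qed

section \<open>What the spectrum reveals about the connection set\<close>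

lemma norm_circulant_eigenvalue_le: "norm (circulant_eigenvalue n S k) \<le> real (card S)"
  unfolding circulant_eigenvalue_def
  by (rule order_trans[OF norm_sum]) (simp add: norm_power)

lemma circulant_eigenvalue_0: "circulant_eigenvalue n S 0 = of_nat (card S)"
  by (simp add: circulant_eigenvalue_def)

text \<open>Negation permutes \<open>S\<close>, so \<open>l\<close> may be replaced by
  \<open>n - l\<close>. Then \<open>w ^ ((n - l) * k)\<close> and \<open>w ^ (l * (n - k))\<close>
  agree, both being inverse to \<open>w ^ (l * k)\<close>.\<close>

lemma circulant_eigenvalue_reflect:
  assumes S: "S \<subseteq> {0<..<n}" and sym: "\<And>l. l \<in> S \<Longrightarrow> n - l \<in> S" and k: "k \<le> n"
  shows "circulant_eigenvalue n S (n - k) = circulant_eigenvalue n S k"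
proof (cases "n = 0")
  case False
  then have n: "n > 0" by simp
  define w where "w = cis (2 * pi / real n)"
  have w0: "w \<noteq> 0" by (simp add: w_def)
  have wn: "w ^ (n * c) = 1" for c
    using cis_root_power[OF n] by (simp add: w_def power_mult)
  have "bij_betw (\<lambda>l. n - l) S S"
    by (rule bij_betw_byWitness[of _ "\<lambda>l. n - l"]) (use S sym in force)+
  then have "circulant_eigenvalue n S k = (\<Sum>l\<in>S. w ^ ((n - l) * k))"
    unfolding circulant_eigenvalue_def w_def
    by (rule sum.reindex_bij_betw[symmetric])
  also have "\<dots> = (\<Sum>l\<in>S. w ^ (l * (n - k)))"
  proof (rule sum.cong)
    fix l assume "l \<in> S"
    then have l: "l \<le> n" using S by force
    have "(n - l) * k + l * k = n * k" using l by (simp flip: add_mult_distrib)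
    then have 1: "w ^ ((n - l) * k) * w ^ (l * k) = 1" by (simp add: wn flip: power_add)
    have "l * (n - k) + l * k = n * l" using k by (simp add: mult.commute[of n] flip: add_mult_distrib2)
    then have "w ^ (l * (n - k)) * w ^ (l * k) = 1" by (simp add: wn flip: power_add)
    then show "w ^ ((n - l) * k) = w ^ (l * (n - k))"
      using 1 w0 by (metis mult_right_cancel power_not_zero)
  qed simp
  finally show ?thesis by (simp add: circulant_eigenvalue_def w_def)
qed (use k in simp)

text \<open>The \<open>m\<close>-th power of a primitive root of order \<open>2 * m\<close> is -1,
  so each \<open>l\<close> contributes \<open>(-1) ^ l\<close>.\<close>

lemma circulant_eigenvalue_half:
  assumes "m > 0" "finite S"
  shows "circulant_eigenvalue (2 * m) S m =
    of_nat (card {l\<in>S. even l}) - of_nat (card {l\<in>S. odd l})"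
proof -
  have "cis (2 * pi / real (2 * m)) ^ m = -1"
    using assms(1) by (simp add: DeMoivre)
  then have "circulant_eigenvalue (2 * m) S m = (\<Sum>l\<in>S. (-1) ^ l)"
    unfolding circulant_eigenvalue_def by (metis (no_types, lifting) mult.commute power_mult)
  also have "\<dots> = (\<Sum>l\<in>{l\<in>S. even l} \<union> {l\<in>S. odd l}. (-1) ^ l)"
    by (rule sum.cong) auto
  also have "\<dots> = (\<Sum>l\<in>{l\<in>S. even l}. (-1) ^ l) + (\<Sum>l\<in>{l\<in>S. odd l}. (-1) ^ l)"
    by (rule sum.union_disjoint) (use assms(2) in auto)
  also have "\<dots> = of_nat (card {l\<in>S. even l}) - of_nat (card {l\<in>S. odd l})"
    by simp
  finally show ?thesis .
qed

text \<open>The indices \<open>k\<close> and \<open>2 * m - k\<close> pair off, except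
  \<open>m\<close>, which is its own partner, and 0, whose partner \<open>2 * m\<close> is out of
  range. Pairs do not affect parity; if \<open>f 0\<close> and \<open>f m\<close> both equal
  \<open>x\<close> they cancel too, hence the exclusive or.\<close>

lemma odd_count_image_mset_reflect:
  fixes m :: nat
  assumes m: "m > 0" and refl: "\<And>k. k \<le> 2 * m \<Longrightarrow> f (2 * m - k) = f k"
  shows "odd (count (image_mset f (mset_set {..<2 * m})) x) \<longleftrightarrow> (f 0 = x) \<noteq> (f m = x)"
proof -
  let ?M = "image_mset f (mset_set {0<..<m})"
  have "{m<..<2 * m} = (\<lambda>k. 2 * m - k) ` {0<..<m}"
  proof
    show "{m<..<2 * m} \<subseteq> (\<lambda>k. 2 * m - k) ` {0<..<m}"
      by (rule subsetI, rule_tac x = "2 * m - x" in image_eqI) auto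
  qed auto
  then have "mset_set {m<..<2 * m} = image_mset (\<lambda>k. 2 * m - k) (mset_set {0<..<m})"
    by (subst image_mset_mset_set) (auto simp: inj_on_def)
  then have upper: "image_mset f (mset_set {m<..<2 * m}) = ?M"
    by (auto simp: multiset.map_comp intro!: image_mset_cong refl)
  have "{..<2 * m} = insert 0 (insert m ({0<..<m} \<union> {m<..<2 * m}))" using m by auto
  then have "image_mset f (mset_set {..<2 * m}) = {#f 0, f m#} + (?M + ?M)"
    using m by (simp add: mset_set_Union upper)
  then show ?thesis by auto
qed

text \<open>The degree of each graph is an eigenvalue of the other, hence at most the other's degree
  in modulus.\<close>

lemma circulant_Spec_eq_imp_card_eq:
  assumes n: "n > 0" and S: "S \<subseteq> {1..n}" "S' \<subseteq> {1..n}"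
    and eq: "Spec (circulant_adj n S) = Spec (circulant_adj n S')"
  shows "card S = card S'"
proof -
  have "card T \<le> card T'"
    if T: "T \<subseteq> {1..n}" "T' \<subseteq> {1..n}" "Spec (circulant_adj n T) = Spec (circulant_adj n T')" for T T'
  proof -
    have "circulant_eigenvalue n T 0 \<in># Spec (circulant_adj n T')"
      using T n by (simp add: Spec_circulant_adj flip: T(3))
    then obtain k where "of_nat (card T) = circulant_eigenvalue n T' k"
      using T n by (auto simp: Spec_circulant_adj circulant_eigenvalue_0)
    then show ?thesis using norm_circulant_eigenvalue_le[of n T' k] by (metis norm_of_nat of_nat_le_iff)
  qed
  then show ?thesis using S eq by (metis antisym)
qed

lemma circulant_Spec_eq_imp_card_parity_eq:
  assumes m: "m > 0" and S: "S \<subseteq> {0<..<2 * m}" "S' \<subseteq> {0<..<2 * m}"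
    and sym: "\<And>l. l \<in> S \<Longrightarrow> 2 * m - l \<in> S" "\<And>l. l \<in> S' \<Longrightarrow> 2 * m - l \<in> S'"
    and eq: "Spec (circulant_adj (2 * m) S) = Spec (circulant_adj (2 * m) S')"
  shows "card {l\<in>S. even l} = card {l\<in>S'. even l}" "card {l\<in>S. odd l} = card {l\<in>S'. odd l}"
proof -
  have n: "2 * m > 0" using m by simp
  have S1: "S \<subseteq> {1..2 * m}" "S' \<subseteq> {1..2 * m}" using S by force+
  have fin: "finite S" "finite S'" using S finite_subset by blast+
  have card: "card S = card S'"
    by (rule circulant_Spec_eq_imp_card_eq[OF n S1 eq])
  let ?e = "circulant_eigenvalue (2 * m)"
  have odd: "odd (count (Spec (circulant_adj (2 * m) T)) x) \<longleftrightarrow> (?e T 0 = x) \<noteq> (?e T m = x)"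
    if "T \<subseteq> {0<..<2 * m}" "\<And>l. l \<in> T \<Longrightarrow> 2 * m - l \<in> T" for T x
  proof -
    have "T \<subseteq> {1..2 * m}" using that(1) by force
    then show ?thesis
      using odd_count_image_mset_reflect[OF m, of "?e T"] circulant_eigenvalue_reflect[of T "2 * m"] that
      by (simp add: Spec_circulant_adj[OF n])
  qed
  have "?e S 0 = ?e S' 0" using card by (simp add: circulant_eigenvalue_0)
  \<comment> \<open>Test the parity of the multiplicity at \<open>x = ?e S m\<close>. The two values
    at index 0 agree, so their comparison with \<open>x\<close> cancels from both exclusive
    ors.\<close>
  then have "?e S m = ?e S' m"
    using odd[OF S(1) sym(1), of "?e S m"] odd[OF S(2) sym(2), of "?e S m"] eq by metis
  \<comment> \<open>The difference may be negative, so it is pulled back from the complex numbers to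
    integers rather than naturals.\<close>
  then have "complex_of_int (int (card {l\<in>S. even l}) - int (card {l\<in>S. odd l})) =
      complex_of_int (int (card {l\<in>S'. even l}) - int (card {l\<in>S'. odd l}))"
    by (simp only: circulant_eigenvalue_half[OF m] fin of_int_diff of_int_of_nat_eq)
  then have diff: "int (card {l\<in>S. even l}) - int (card {l\<in>S. odd l}) =
      int (card {l\<in>S'. even l}) - int (card {l\<in>S'. odd l})"
    by (simp only: of_int_eq_iff)
  have "card T = card {l\<in>T. even l} + card {l\<in>T. odd l}" if "finite T" for T :: "nat set"
  proof -
    have "T = {l\<in>T. even l} \<union> {l\<in>T. odd l}" by blast
    then show ?thesis
      using card_Un_disjoint[of "{l\<in>T. even l}" "{l\<in>T. odd l}"] that by (simp add: disjoint_iff)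
  qed
  from this[OF fin(1)] this[OF fin(2)] card have sum: "card {l\<in>S. even l} + card {l\<in>S. odd l} = card {l\<in>S'. even l} + card {l\<in>S'. odd l}"
    by linarith
  show "card {l\<in>S. even l} = card {l\<in>S'. even l}" "card {l\<in>S. odd l} = card {l\<in>S'. odd l}"
    using diff sum by linarith+
qed

section \<open>Integral circulant graphs\<close>

text \<open>Excluding the divisor \<open>n\<close> excludes \<open>l = n\<close>, the representative
  of 0, so there are no loops.\<close>

lemma conn_set_bounds:
  assumes "D \<subseteq> divisors_n n - {n}"
  shows "conn_set n D \<subseteq> {0<..<n}"
proof
  fix l assume "l \<in> conn_set n D"
  then have l: "1 \<le> l" "l \<le> n" "gcd l n \<noteq> n" using assms by (auto simp: conn_set_def G_n_def)
  then show "l \<in> {0<..<n}" by (cases "l = n") auto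
qed

lemma conn_set_reflect:
  assumes "D \<subseteq> divisors_n n - {n}" "l \<in> conn_set n D"
  shows "n - l \<in> conn_set n D"
proof -
  have l: "0 < l" "l < n" using conn_set_bounds[OF assms(1)] assms(2) by auto
  then have "gcd (n - l) n = gcd l n"
    by (metis gcd_diff2_nat less_imp_le_nat)
  then show ?thesis using assms(2) l by (auto simp: conn_set_def G_n_def)
qed

text \<open>As \<open>n\<close> is even, \<open>l\<close> and \<open>gcd l n\<close> have the same
  parity, so splitting the connection set by parity splits \<open>D\<close> by parity. Each class
  \<open>G_n n d\<close> has \<open>totient (n div d)\<close> elements.\<close>

lemma card_conn_set_parity:
  assumes n: "n > 0" "even n" and D: "D \<subseteq> divisors_n n"
  shows "card {l\<in>conn_set n D. even l = b} = (\<Sum>d\<in>{d\<in>D. even d = b}. totient (n div d))"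
proof -
  have finD: "finite D"
    by (rule finite_subset[OF D], rule finite_subset[of _ "{..n}"])
       (use n in \<open>auto simp: divisors_n_def dest: dvd_imp_le\<close>)
  have "even l \<longleftrightarrow> even d" if "l \<in> G_n n d" for l d
    using that n(2) by (auto simp: G_n_def)
  then have "{l\<in>conn_set n D. even l = b} = (\<Union>d\<in>{d\<in>D. even d = b}. G_n n d)"
    unfolding conn_set_def by blast
  also have "card \<dots> = (\<Sum>d\<in>{d\<in>D. even d = b}. card (G_n n d))"
    by (rule card_UN_disjoint) (use finD in \<open>auto simp: G_n_def\<close>)
  also have "\<dots> = (\<Sum>d\<in>{d\<in>D. even d = b}. totient (n div d))"
  proof (rule sum.cong)
    fix d assume "d \<in> {d\<in>D. even d = b}"
    then have "d dvd n" using D by (auto simp: divisors_n_def)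
    moreover have "G_n n d = {k\<in>{0<..n}. gcd k n = d}" by (auto simp: G_n_def)
    ultimately show "card (G_n n d) = totient (n div d)"
      using card_gcd_eq_totient[OF n(1)] by simp
  qed simp
  finally show ?thesis .
qed

text \<open>Here \<open>h\<close> gives the codivisor met in the count, which need not divide
  \<open>m\<close>; \<open>g\<close> replaces it by a divisor of \<open>m\<close> with the same
  totient, injectively, so that uniqueness of subset sums applies.\<close>

lemma distinct_totient_sums_codivisors:
  assumes m: "distinct_totient_sums m"
    and g: "inj_on g X" "g ` X \<subseteq> {e. e dvd m}" "\<And>d. d \<in> X \<Longrightarrow> totient (h d) = totient (g d)"
    and sub: "Y \<subseteq> X" "Y' \<subseteq> X" and eq: "(\<Sum>d\<in>Y. totient (h d)) = (\<Sum>d\<in>Y'. totient (h d))"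
  shows "Y = Y'"
proof -
  have "(\<Sum>d\<in>Z. totient (h d)) = sum totient (g ` Z)" if "Z \<subseteq> X" for Z
    using that g(3) inj_on_subset[OF g(1) that]
    by (subst sum.reindex) (auto intro!: sum.cong)
  then have "sum totient (g ` Y) = sum totient (g ` Y')" using sub eq by metis
  then have "g ` Y = g ` Y'"
    using sub g(2) by (intro inj_onD[OF m[unfolded distinct_totient_sums_def]]) auto
  then show ?thesis using g(1) sub by (simp add: inj_on_image_eq_iff)
qed

lemma inj_on_div_divisors:
  fixes n :: nat
  assumes "n > 0"
  shows "inj_on (\<lambda>d. n div d) {d. d dvd n}"
  by (rule inj_onI) (use assms in \<open>metis mem_Collect_eq dvd_div_eq_mult dvd_mult_div_cancel
    mult_cancel1 mult_is_0 not_gr0\<close>)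

theorem theorem1p4:
  fixes n s :: nat and p J :: "nat \<Rightarrow> nat" and D1 D2 :: "nat set"
  assumes "s \<ge> 2"
    and "\<And>i. i \<in> {1..s} \<Longrightarrow> prime (p i) \<and> odd (p i) \<and> J i \<ge> 1"
    and "inj_on p {1..s}"
    and "\<And>r. r \<in> {1..s-1} \<Longrightarrow> (\<Prod>i=1..r. p i ^ J i) < p (r + 1)"
    and "n = 2 * (\<Prod>i=1..s. p i ^ J i)"
    and "D1 \<subseteq> divisors_n n - {n}"
    and "D2 \<subseteq> divisors_n n - {n}"
    and "Spec (ICG_adj n D1) = Spec (ICG_adj n D2)"
  shows "D1 = D2"
proof -
  define m where "m = (\<Prod>i=1..s. p i ^ J i)"
  have "distinct_totient_sums m \<and> odd m"
    unfolding m_def by (rule distinct_totient_sums_prod) (use assms(2,4) in auto)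
  then have m: "distinct_totient_sums m" "odd m" by auto
  have m0: "m > 0" using m(2) by (cases m) auto
  have n: "n = 2 * m" "n > 0" "even n" using assms(5) m0 by (auto simp: m_def)
  note parity = circulant_Spec_eq_imp_card_parity_eq[OF m0, folded n(1),
      OF conn_set_bounds[OF assms(6)] conn_set_bounds[OF assms(7)]
      conn_set_reflect[OF assms(6)] conn_set_reflect[OF assms(7)] assms(8)[unfolded ICG_adj_def]]
  have sub: "D1 \<subseteq> divisors_n n" "D2 \<subseteq> divisors_n n" using assms(6,7) by auto
  have sums: "(\<Sum>d\<in>{d\<in>D1. even d = b}. totient (n div d)) = (\<Sum>d\<in>{d\<in>D2. even d = b}. totient (n div d))"
    for b
    using parity card_conn_set_parity[OF n(2,3) sub(1), of b] card_conn_set_parity[OF n(2,3) sub(2), of b]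
    by (cases b) auto
  \<comment> \<open>For even \<open>d\<close> the codivisor \<open>n div d\<close> already divides
    \<open>m\<close>, so it serves as both \<open>g\<close> and \<open>h\<close>.\<close>
  have "{d\<in>D1. even d = True} = {d\<in>D2. even d = True}"
  proof (rule distinct_totient_sums_codivisors[OF m(1) _ _ _ _ _ sums])
    show "inj_on (\<lambda>d. n div d) {d. d dvd n \<and> even d}"
      by (rule inj_on_subset[OF inj_on_div_divisors[OF n(2)]]) auto
    show "(\<lambda>d. n div d) ` {d. d dvd n \<and> even d} \<subseteq> {e. e dvd m}"
      using m0 by (auto simp: n(1) elim!: evenE)
  qed (use sub in \<open>auto simp: divisors_n_def\<close>)
  \<comment> \<open>For odd \<open>d\<close> the codivisor is twice the odd number
    \<open>m div d\<close>. Doubling an odd number preserves its totient, so \<open>m div d\<close>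
    takes the role of \<open>g\<close>.\<close>
  moreover have "{d\<in>D1. even d = False} = {d\<in>D2. even d = False}"
  proof (rule distinct_totient_sums_codivisors[OF m(1) _ _ _ _ _ sums])
    have odd_dvd: "d dvd m" if "d dvd n" "odd d" for d
      using that by (simp add: n(1) coprime_dvd_mult_right_iff)
    show "inj_on (\<lambda>d. m div d) {d. d dvd n \<and> odd d}"
      by (rule inj_on_subset[OF inj_on_div_divisors[OF m0]]) (use odd_dvd in auto)
    show "(\<lambda>d. m div d) ` {d. d dvd n \<and> odd d} \<subseteq> {e. e dvd m}"
      using odd_dvd by (auto intro: div_dvd_iff_mult[THEN iffD2] dest: odd_pos)
    show "totient (n div d) = totient (m div d)" if "d \<in> {d. d dvd n \<and> odd d}" for d
    proof -
      have d: "d dvd m" using odd_dvd that by auto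
      then have "n div d = 2 * (m div d)" by (simp add: n(1) div_mult_swap)
      moreover have "odd (m div d)" using d m(2) by (metis dvd_mult_div_cancel even_mult_iff)
      ultimately show ?thesis by (simp add: totient_double)
    qed
  qed (use sub in \<open>auto simp: divisors_n_def\<close>)
  ultimately show ?thesis by auto
qed

end
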